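(* Let $N\ge 3$ be an integer, $h=1/N$ and $\lambda>0$. For every piecewise constant function $v_h=\sum_{n=1}^N v_n\boldsymbol 1_{I_n}\in V_{h0}$, with associated vector $\mathbf v=(v_1,\dots,v_{N-1})^{\mathrm T}\in\mathbb R^{N-1}$, one has the exact identity $$\frac{\lambda}{2}\|v_h\|_{H^{-1}_{\mathrm{av}}(\mathbb T)}^2=\frac{\lambda h^3}{2}\,\|H\mathbf v\|_2^2,\qquad H=T S_N R_N A_N^{-1}\in\mathbb R^{N\times(N-1)},$$ where $\|\cdot\|_2$ is the Euclidean norm on $\mathbb R^N$.
   Context: $\mathbb T=\mathbb R/\mathbb Z$, identified with $[0,1]$ with periodic boundary condition. For a distribution $f$ on $\mathbb T$, $\widehat f_T(\xi)=\langle f,e^{-2\pi i\xi x}\rangle$, $\xi\in\mathbb Z$, denotes its Fourier coefficients. $H^{-1}_{\mathrm{av}}(\mathbb T)$ is the space of distributions $f$ on $\mathbb T$ with $\widehat f_T(0)=0$ and $\sum_{\xi\ne0}\xi^{-2}|\widehat f_T(\xi)|^2<\infty$, with norm $\|f\|_{H^{-1}_{\mathrm{av}}(\mathbb T)}^2=\sum_{\xi\neq0}\frac{1}{4\pi^2}\xi^{-2}|\widehat f_T(\xi)|^2$. Grid: $x_n=nh$, $x_{n+1/2}=(n+1/2)h$, and $I_n=[x_{n-1/2},x_{n+1/2})$, understood periodically (as subsets of $\mathbb T$), for $n=1,\dots,N$. $\boldsymbol 1_{I_n}$ is the characteristic function of $I_n$. $V_{h0}$ is the space of real functions $v_h=\sum_{n=1}^N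 v_n\boldsymbol 1_{I_n}$ on $\mathbb T$ with $\sum_{n=1}^N v_n=0$; it is a subspace of $H^{-1}_{\mathrm{av}}(\mathbb T)$. Matrices: - $S_N\in\mathbb R^{N\times N}$ is the periodic backward difference matrix: $(S_N\mathbf y)_n=y_n-y_{n-1}$ for $n=1,\dots,N$, with $y_0:=y_N$. - $R_N\in\mathbb R^{N\times(N-1)}$ has the identity matrix of size $N-1$ as its first $N-1$ rows and $(-1,-1,\dots,-1)$ as its last row. - $L_N\in\mathbb R^{(N-1)\times N}$ has entries $(L_N)_{ij}=\delta_{ij}-\frac1N$ for $1\le i\le N-1$, $1\le j\le N$. - $A_N=L_NS_N^{\mathrm T}S_NR_N\in\mathbb R^{(N-1)\times(N-1)}$, which is invertible. - $T\in\mathbb R^{N\times N}$ is the circulant matrix given by $(T\mathbf y)_n=a\,y_n+b\,y_{n-1}$ for $n=1,\dots,N$, with $y_0:=y_N$, $a=\frac{\sqrt3+1}{2\sqrt3}$, $b=\frac{\sqrt3-1}{2\sqrt3}$. *)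

theory Defs
  imports "HOL-Analysis.Analysis" "Jordan_Normal_Form.Gauss_Jordan_Elimination"
    "Jordan_Normal_Form.Determinant"
begin

(* HOL-Analysis and Jordan_Normal_Form both use this notation; here it means vec_index only. *)
no_notation vec_nth (infixl "$" 90)

section \<open>Distributions on the torus\<close>

text \<open>Functions on the torus are 1-periodic functions on the real line.  The test functions are
  the smooth complex-valued ones.\<close>

definition periodic1 :: "(real \<Rightarrow> 'a) \<Rightarrow> bool" where
  "periodic1 f \<longleftrightarrow> (\<forall>x. f (x + 1) = f x)"

primrec iter_deriv :: "nat \<Rightarrow> (real \<Rightarrow> complex) \<Rightarrow> real \<Rightarrow> complex" where
  "iter_deriv 0 \<phi> = \<phi>"
| "iter_deriv (Suc k) \<phi> = (\<lambda>x. vector_derivative (iter_deriv k \<phi>) (at x))"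

definition test_functions :: "(real \<Rightarrow> complex) set" where
  "test_functions = {\<phi>. periodic1 \<phi> \<and> (\<forall>k x. iter_deriv k \<phi> differentiable (at x))}"

text \<open>A distribution is a complex-linear functional on the test functions that is continuous for
  the Frechet topology, i.e. bounded by finitely many of the seminorms
  \<open>\<phi> \<mapsto> sup \<bar>\<phi>\<^sup>(\<^sup>j\<^sup>)\<bar>\<close>.  Its values outside \<open>test_functions\<close> are irrelevant.\<close>

definition distribution :: "((real \<Rightarrow> complex) \<Rightarrow> complex) \<Rightarrow> bool" where
  "distribution u \<longleftrightarrow>
     (\<forall>\<phi>\<in>test_functions. \<forall>\<psi>\<in>test_functions. u (\<lambda>x. \<phi> x + \<psi> x) = u \<phi> + u \<psi>) \<and>
     (\<forall>c. \<forall>\<phi>\<in>test_functions. u (\<lambda>x. c * \<phi> x) = c * u \<phi>) \<and>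
     (\<exists>m C. \<forall>\<phi>\<in>test_functions.
        norm (u \<phi>) \<le> C * (\<Sum>j\<le>m. SUP x\<in>{0..1}. norm (iter_deriv j \<phi> x)))"

definition dist_of_fun :: "(real \<Rightarrow> real) \<Rightarrow> (real \<Rightarrow> complex) \<Rightarrow> complex" where
  "dist_of_fun f \<phi> = (LINT x:{0..1}|lborel. of_real (f x) * \<phi> x)"

definition fourier_coeff :: "((real \<Rightarrow> complex) \<Rightarrow> complex) \<Rightarrow> int \<Rightarrow> complex" where
  "fourier_coeff u \<xi> = u (\<lambda>x. exp (- 2 * of_real pi * \<i> * of_int \<xi> * of_real x))"

definition Hm1av :: "((real \<Rightarrow> complex) \<Rightarrow> complex) set" where
  "Hm1av = {u. distribution u \<and> fourier_coeff u 0 = 0 \<and>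
     (\<lambda>\<xi>. (norm (fourier_coeff u \<xi>))\<^sup>2 / (real_of_int \<xi>)\<^sup>2) summable_on (UNIV - {0})}"

definition Hm1av_norm :: "((real \<Rightarrow> complex) \<Rightarrow> complex) \<Rightarrow> real" where
  "Hm1av_norm u =
     sqrt (\<Sum>\<^sub>\<infinity>\<xi>\<in>UNIV - {0}. 1 / (4 * pi\<^sup>2) * ((norm (fourier_coeff u \<xi>))\<^sup>2 / (real_of_int \<xi>)\<^sup>2))"

section \<open>Piecewise constant functions\<close>

definition grid_interval :: "real \<Rightarrow> nat \<Rightarrow> real set" where
  "grid_interval h n =
     {x. \<exists>k::int. x + of_int k \<in> {(real n - 1/2) * h ..< (real n + 1/2) * h}}"

definition step_fun :: "nat \<Rightarrow> real \<Rightarrow> (nat \<Rightarrow> real) \<Rightarrow> real \<Rightarrow> real" where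
  "step_fun N h v = (\<lambda>x. \<Sum>n=1..N. v n * indicator (grid_interval h n) x)"

definition V_h0 :: "nat \<Rightarrow> real \<Rightarrow> (real \<Rightarrow> real) set" where
  "V_h0 N h = {step_fun N h v | v. (\<Sum>n=1..N. v n) = 0}"

section \<open>Matrices\<close>

text \<open>Rows and columns are numbered from 0: index \<open>i\<close> stands for \<open>n = i + 1\<close>.\<close>

definition cyc_pred :: "nat \<Rightarrow> nat \<Rightarrow> nat" where
  "cyc_pred N i = (if i = 0 then N - 1 else i - 1)"

definition S_mat :: "nat \<Rightarrow> real mat" where
  "S_mat N = mat N N (\<lambda>(i, j). of_bool (j = i) - of_bool (j = cyc_pred N i))"

definition R_mat :: "nat \<Rightarrow> real mat" where
  "R_mat N = mat N (N - 1) (\<lambda>(i, j). if i < N - 1 then of_bool (i = j) else - 1)"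

definition L_mat :: "nat \<Rightarrow> real mat" where
  "L_mat N = mat (N - 1) N (\<lambda>(i, j). of_bool (i = j) - 1 / real N)"

definition A_mat :: "nat \<Rightarrow> real mat" where
  "A_mat N = L_mat N * transpose_mat (S_mat N) * S_mat N * R_mat N"

definition T_mat :: "nat \<Rightarrow> real mat" where
  "T_mat N = mat N N (\<lambda>(i, j). (sqrt 3 + 1) / (2 * sqrt 3) * of_bool (j = i)
                              + (sqrt 3 - 1) / (2 * sqrt 3) * of_bool (j = cyc_pred N i))"

definition H_mat :: "nat \<Rightarrow> real mat" where
  "H_mat N = T_mat N * S_mat N * R_mat N * the (mat_inverse (A_mat N))"

definition eucl_norm :: "real vec \<Rightarrow> real" where
  "eucl_norm w = L2_set (\<lambda>i. w $ i) {..<dim_vec w}"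

lemma cyc_pred_less: "i < N \<Longrightarrow> cyc_pred N i < N"
  by (auto simp: cyc_pred_def)

lemma sum_of_bool_mult:
  fixes y :: "nat \<Rightarrow> real"
  assumes "k < N"
  shows "(\<Sum>j = 0..<N. of_bool (j = k) * y j) = y k"
proof -
  have "(\<Sum>j = 0..<N. of_bool (j = k) * y j) = (\<Sum>j = 0..<N. if j = k then y j else 0)"
    by (rule sum.cong) auto
  then show ?thesis using assms by simp
qed

lemma S_mat_mult_vec:
  assumes "y \<in> carrier_vec N" "i < N"
  shows "(S_mat N *\<^sub>v y) $ i = y $ i - y $ cyc_pred N i"
  using assms cyc_pred_less[of i N]
  by (simp add: S_mat_def scalar_prod_def left_diff_distrib sum_subtractf sum_of_bool_mult)

lemma T_mat_mult_vec:
  assumes "y \<in> carrier_vec N" "i < N"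
  shows "(T_mat N *\<^sub>v y) $ i = (sqrt 3 + 1) / (2 * sqrt 3) * y $ i
                             + (sqrt 3 - 1) / (2 * sqrt 3) * y $ cyc_pred N i"
  using assms cyc_pred_less[of i N]
  by (simp add: T_mat_def scalar_prod_def distrib_right sum.distrib mult.assoc
      sum_distrib_left[symmetric] sum_of_bool_mult del: times_divide_eq_left)


lemma A_mat_invertible:
  assumes "N \<ge> 3"
  shows "mat_inverse (A_mat N) \<noteq> None"
    and "A_mat N * the (mat_inverse (A_mat N)) = 1\<^sub>m (N - 1)"
proof -
  have S: "S_mat N \<in> carrier_mat N N" and R: "R_mat N \<in> carrier_mat N (N - 1)"
    and L: "L_mat N \<in> carrier_mat (N - 1) N"
    by (simp_all add: S_mat_def R_mat_def L_mat_def)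
  have A: "A_mat N \<in> carrier_mat (N - 1) (N - 1)"
    unfolding A_mat_def using S R L by (intro mult_carrier_mat transpose_carrier_mat) auto
  have "v = 0\<^sub>v (N - 1)" if v: "v \<in> carrier_vec (N - 1)" and Av: "A_mat N *\<^sub>v v = 0\<^sub>v (N - 1)" for v
  proof -
    define z where "z = R_mat N *\<^sub>v v"
    define w where "w = S_mat N *\<^sub>v z"
    define u where "u = transpose_mat (S_mat N) *\<^sub>v w"
    have zc: "z \<in> carrier_vec N" unfolding z_def using R v by auto
    have wc: "w \<in> carrier_vec N" unfolding w_def using S zc by auto
    have uc: "u \<in> carrier_vec N" unfolding u_def using S wc by auto
    have St: "transpose_mat (S_mat N) \<in> carrier_mat N N" using S by simp
    have Lu: "L_mat N *\<^sub>v u = 0\<^sub>v (N - 1)"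
    proof -
      have "A_mat N *\<^sub>v v = (L_mat N * transpose_mat (S_mat N) * S_mat N) *\<^sub>v z"
        unfolding A_mat_def z_def using S St R L v
        by (intro assoc_mult_mat_vec mult_carrier_mat) auto
      also have "\<dots> = (L_mat N * transpose_mat (S_mat N)) *\<^sub>v w"
        unfolding w_def using S St R L zc
        by (intro assoc_mult_mat_vec mult_carrier_mat) auto
      also have "\<dots> = L_mat N *\<^sub>v u"
        unfolding u_def using S St L wc
        by (intro assoc_mult_mat_vec) auto
      finally show ?thesis using Av by simp
    qed
    define m where "m = (\<Sum>j = 0..<N. u $ j) / real N"
    have ui: "u $ i = m" if i: "i < N - 1" for i
    proof -
      have "(L_mat N *\<^sub>v u) $ i = (\<Sum>j = 0..<N. (of_bool (j = i) - 1 / real N) * u $ j)"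
      proof -
        have "(L_mat N *\<^sub>v u) $ i = (\<Sum>j = 0..<N. row (L_mat N) i $ j * u $ j)"
          using i uc L by (simp add: scalar_prod_def)
        also have "\<dots> = (\<Sum>j = 0..<N. (of_bool (j = i) - 1 / real N) * u $ j)"
          using i by (intro sum.cong refl) (auto simp: L_mat_def)
        finally show ?thesis .
      qed
      also have "\<dots> = u $ i - m"
        using i by (simp add: left_diff_distrib sum_subtractf sum_of_bool_mult m_def sum_divide_distrib)
      finally show ?thesis using Lu i by simp
    qed
    have split: "{0..<N} = insert (N - 1) {0..<N - 1}" using assms by auto
    have usum: "(\<Sum>j = 0..<N. u $ j) = real N * m" using assms by (simp add: m_def)
    have ul: "u $ (N - 1) = m"
    proof -
      have "(\<Sum>j = 0..<N. u $ j) = u $ (N - 1) + (\<Sum>j = 0..<N - 1. u $ j)"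
        unfolding split by simp
      also have "(\<Sum>j = 0..<N - 1. u $ j) = real (N - 1) * m" by (simp add: ui)
      finally show ?thesis using usum assms by (simp add: of_nat_diff algebra_simps)
    qed
    have uall: "u $ i = m" if "i < N" for i
      using ui ul that by (cases "i = N - 1") auto
    have zi: "z $ i = v $ i" if i: "i < N - 1" for i
    proof -
      have "z $ i = (\<Sum>j = 0..<N - 1. of_bool (j = i) * v $ j)"
      proof -
        have "z $ i = (\<Sum>j = 0..<N - 1. row (R_mat N) i $ j * v $ j)"
          using i v R by (simp add: z_def scalar_prod_def)
        also have "\<dots> = (\<Sum>j = 0..<N - 1. of_bool (j = i) * v $ j)"
          using i by (intro sum.cong refl) (auto simp: R_mat_def)
        finally show ?thesis .
      qed
      then show ?thesis using i by (simp add: sum_of_bool_mult)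
    qed
    have zl: "z $ (N - 1) = - (\<Sum>j = 0..<N - 1. v $ j)"
      using v assms by (simp add: z_def R_mat_def scalar_prod_def sum_negf)
    have zsum: "(\<Sum>j = 0..<N. z $ j) = 0"
      unfolding split using zi zl by simp
    have "w \<bullet> w = u \<bullet> z"
      unfolding u_def w_def using transpose_vec_mult_scalar[OF S zc, of w] wc by (simp add: w_def)
    also have "\<dots> = (\<Sum>j = 0..<N. m * z $ j)"
      using zc by (simp add: scalar_prod_def uall)
    also have "\<dots> = 0" by (simp add: sum_distrib_left[symmetric] zsum)
    finally have "(\<Sum>j = 0..<N. w $ j * w $ j) = 0" using wc by (simp add: scalar_prod_def)
    then have w0: "w $ j = 0" if "j < N" for j
      using that by (subst (asm) sum_nonneg_eq_0_iff) auto
    have zc0: "z $ i = z $ 0" if "i < N" for i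
      using that
    proof (induction i)
      case (Suc i)
      then show ?case using S_mat_mult_vec[OF zc, of "Suc i"] w0[of "Suc i"]
        by (simp add: w_def cyc_pred_def)
    qed simp
    have "(\<Sum>j = 0..<N. z $ j) = (\<Sum>j = 0..<N. z $ 0)"
      by (rule sum.cong[OF refl]) (rule zc0, simp)
    then have z0: "z $ 0 = 0" using assms zsum by simp
    have "v $ i = 0" if "i < N - 1" for i
    proof -
      have "i < N" using that by simp
      from zc0[OF this] zi[OF that] z0 show ?thesis by (simp only:)
    qed
    then show ?thesis using v by (intro eq_vecI) auto
  qed
  then have "det (A_mat N) \<noteq> 0" using det_0_iff_vec_prod_zero[OF A] by blast
  from det_non_zero_imp_unit[OF A this, of "()"]
  show ne: "mat_inverse (A_mat N) \<noteq> None" using mat_inverse(1)[OF A, of "()"] by blast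
  then obtain B where "mat_inverse (A_mat N) = Some B" by auto
  then show "A_mat N * the (mat_inverse (A_mat N)) = 1\<^sub>m (N - 1)"
    using mat_inverse(2)[OF A] by auto
qed

lemma grid_interval_borel [measurable]: "grid_interval h n \<in> sets borel"
proof -
  have "grid_interval h n =
      (\<Union>k::int. {(real n - 1/2) * h - of_int k ..< (real n + 1/2) * h - of_int k})"
    by (auto simp: grid_interval_def algebra_simps)
  then show ?thesis by simp
qed

lemma step_fun_borel [measurable]: "step_fun N h v \<in> borel_measurable borel"
  unfolding step_fun_def by measurable

lemma step_fun_bound: "\<bar>step_fun N h v x\<bar> \<le> (\<Sum>n=1..N. \<bar>v n\<bar>)"
  unfolding step_fun_def
  by (rule order_trans[OF sum_abs], rule sum_mono) (auto simp: indicator_def)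

lemma step_fun_set_integrable:
  assumes "continuous_on UNIV (\<phi> :: real \<Rightarrow> complex)"
  shows "set_integrable lborel {0..1} (\<lambda>x. of_real (step_fun N h v x) * \<phi> x)"
proof (rule set_integrable_bound)
  show "set_integrable lborel {0..1} (\<lambda>x. of_real (\<Sum>n=1..N. \<bar>v n\<bar>) * \<phi> x)"
    unfolding set_integrable_def using assms
    by (intro borel_integrable_compact) (auto intro!: continuous_intros intro: continuous_on_subset)
  have [measurable]: "\<phi> \<in> borel_measurable borel"
    using assms by (rule borel_measurable_continuous_onI)
  show "set_borel_measurable lborel {0..1} (\<lambda>x. of_real (step_fun N h v x) * \<phi> x)"
    unfolding set_borel_measurable_def by measurable
  show "AE x in lborel. x \<in> {0..1} \<longrightarrow> norm (complex_of_real (step_fun N h v x) * \<phi> x)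
      \<le> norm (complex_of_real (\<Sum>n=1..N. \<bar>v n\<bar>) * \<phi> x)"
    using step_fun_bound[of N h v]
    by (intro AE_I2) (auto simp: norm_mult simp del: of_real_sum intro!: mult_right_mono
        intro: order_trans[OF _ abs_ge_self])
qed

lemma dist_of_step_fun_bound:
  assumes "continuous_on UNIV (\<phi> :: real \<Rightarrow> complex)" "\<And>x. x \<in> {0..1} \<Longrightarrow> norm (\<phi> x) \<le> K"
  shows "norm (dist_of_fun (step_fun N h v) \<phi>) \<le> (\<Sum>n=1..N. \<bar>v n\<bar>) * K"
proof -
  let ?B = "\<Sum>n=1..N. \<bar>v n\<bar>"
  have "norm (dist_of_fun (step_fun N h v) \<phi>)
      \<le> (LINT x:{0..1}|lborel. norm (of_real (step_fun N h v x) * \<phi> x))"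
    unfolding dist_of_fun_def
    by (rule set_integral_norm_bound[OF step_fun_set_integrable[OF assms(1)]])
  also have "\<dots> \<le> (LINT x:{0..1::real}|lborel. ?B * K)"
  proof (rule set_integral_mono)
    show "set_integrable lborel {0..1} (\<lambda>x. norm (complex_of_real (step_fun N h v x) * \<phi> x))"
      by (rule set_integrable_norm[OF step_fun_set_integrable[OF assms(1)]])
    show "set_integrable lborel {0..1::real} (\<lambda>x. ?B * K)"
      unfolding set_integrable_def by (intro borel_integrable_compact) auto
    show "norm (complex_of_real (step_fun N h v x) * \<phi> x) \<le> ?B * K" if "x \<in> {0..1}" for x
      using that assms(2)[OF that] step_fun_bound[of N h v x]
      by (auto simp: norm_mult intro!: mult_mono sum_nonneg)
  qed
  also have "\<dots> = ?B * K" by (simp add: set_lebesgue_integral_def)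
  finally show ?thesis .
qed

lemma test_functions_continuous:
  assumes "\<phi> \<in> test_functions"
  shows "continuous_on UNIV \<phi>"
proof -
  have "iter_deriv 0 \<phi> differentiable (at x)" for x
    using assms unfolding test_functions_def by blast
  then show ?thesis
    by (auto intro!: continuous_at_imp_continuous_on differentiable_imp_continuous_within)
qed

lemma measure_grid_interval:
  assumes "N \<ge> 3" "h = 1 / real N" "n \<in> {1..N}"
  shows "measure lborel (grid_interval h n \<inter> {0..1}) = h"
proof -
  have h: "h > 0" "h \<le> 1/3"
    using assms(1) unfolding assms(2) by (simp_all add: frac_le)
  have Nh: "real N * h = 1" using assms by simp
  have lo: "(real n - 1/2) * h \<ge> h / 2"
  proof -
    have "1/2 * h \<le> (real n - 1/2) * h" using assms h by (intro mult_right_mono) auto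
    then show ?thesis by simp
  qed
  show ?thesis
  proof (cases "n = N")
    case False
    have hi: "(real n + 1/2) * h \<le> 1 - h / 2"
    proof -
      have "(real n + 1/2) * h \<le> (real N - 1/2) * h"
        using False assms h by (intro mult_right_mono) auto
      then show ?thesis using Nh by (simp add: algebra_simps)
    qed
    have "grid_interval h n \<inter> {0..1} = {(real n - 1/2) * h ..< (real n + 1/2) * h}"
    proof (intro Set.set_eqI iffI)
      fix x assume "x \<in> grid_interval h n \<inter> {0..1}"
      then obtain k :: int where x: "0 \<le> x" "x \<le> 1"
        "(real n - 1/2) * h \<le> x + of_int k" "x + of_int k < (real n + 1/2) * h"
        by (auto simp: grid_interval_def)
      have "of_int k < (1::real)" "of_int k > (-1::real)" using x lo hi h by linarith+
      then have "k = 0" by linarith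
      then show "x \<in> {(real n - 1/2) * h ..< (real n + 1/2) * h}" using x by simp
    next
      fix x assume x: "x \<in> {(real n - 1/2) * h ..< (real n + 1/2) * h}"
      then have "0 \<le> x" "x \<le> 1" using lo hi h by (simp_all only: atLeastLessThan_iff) linarith+
      with x show "x \<in> grid_interval h n \<inter> {0..1}"
        by (auto simp: grid_interval_def intro!: exI[of _ "0::int"])
    qed
    then show ?thesis using h by (simp add: algebra_simps)
  next
    case True
    have e: "(real n - 1/2) * h = 1 - h/2" "(real n + 1/2) * h = 1 + h/2"
      using True Nh by (simp_all add: algebra_simps)
    have "grid_interval h n \<inter> {0..1} = {0..<h/2} \<union> {1 - h/2..1}"
    proof (intro Set.set_eqI iffI)
      fix x assume "x \<in> grid_interval h n \<inter> {0..1}"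
      then obtain k :: int where x: "0 \<le> x" "x \<le> 1"
        "1 - h/2 \<le> x + of_int k" "x + of_int k < 1 + h/2"
        unfolding grid_interval_def e by auto
      have "of_int k < (2::real)" "of_int k > (-1::real)" using x h by linarith+
      then have "k = 0 \<or> k = 1" by linarith
      then show "x \<in> {0..<h/2} \<union> {1 - h/2..1}" using x by auto
    next
      fix x assume "x \<in> {0..<h/2} \<union> {1 - h/2..1}"
      then show "x \<in> grid_interval h n \<inter> {0..1}"
        unfolding grid_interval_def e using h
        by (auto intro: exI[of _ "0::int"] exI[of _ "1::int"])
    qed
    moreover have "measure lborel ({0..<h/2} \<union> {1 - h/2..1}) = h / 2 + h / 2"
    proof -
      have "{0..<h/2} \<inter> {1 - h/2..1} = {}" using h by auto
      then have "measure lborel ({0..<h/2} \<union> {1 - h/2..1})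
          = measure lborel {0..<h/2} + measure lborel {1 - h/2..1}"
        using h by (intro measure_Union) (simp_all add: emeasure_lborel_Ico emeasure_lborel_Icc)
      then show ?thesis using h by simp
    qed
    ultimately show ?thesis by simp
  qed
qed

lemma V_h0_subset_Hm1av:
  assumes "N \<ge> 3" "h = 1 / real N" "f \<in> V_h0 N h"
  shows "dist_of_fun f \<in> Hm1av"
proof -
  obtain v where f: "f = step_fun N h v" and v: "(\<Sum>n=1..N. v n) = 0"
    using assms(3) by (auto simp: V_h0_def)
  define B where "B = (\<Sum>n=1..N. \<bar>v n\<bar>)"
  have B0: "B \<ge> 0" by (simp add: B_def sum_nonneg)
  let ?u = "dist_of_fun f"
  have int: "set_integrable lborel {0..1} (\<lambda>x. of_real (f x) * \<phi> x)" if "\<phi> \<in> test_functions" for \<phi>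
    unfolding f by (rule step_fun_set_integrable[OF test_functions_continuous[OF that]])
  have "distribution ?u"
    unfolding distribution_def
  proof (intro conjI ballI allI)
    show "?u (\<lambda>x. \<phi> x + \<psi> x) = ?u \<phi> + ?u \<psi>"
      if "\<phi> \<in> test_functions" "\<psi> \<in> test_functions" for \<phi> \<psi>
      unfolding dist_of_fun_def distrib_left
      by (rule set_integral_add(2)[OF int[OF that(1)] int[OF that(2)]])
    show "?u (\<lambda>x. c * \<phi> x) = c * ?u \<phi>" for c \<phi>
      unfolding dist_of_fun_def mult.left_commute[of _ c] by (rule set_integral_mult_right)
    show "\<exists>m C. \<forall>\<phi>\<in>test_functions.
        norm (?u \<phi>) \<le> C * (\<Sum>j\<le>m. SUP x\<in>{0..1}. norm (iter_deriv j \<phi> x))"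
    proof (intro exI[of _ "0::nat"] exI[of _ B] ballI)
      fix \<phi> assume "\<phi> \<in> test_functions"
      note c = test_functions_continuous[OF this]
      have "compact ((\<lambda>x. norm (\<phi> x)) ` {0..1})"
        by (intro compact_continuous_image continuous_intros continuous_on_subset[OF c]) auto
      then have "bdd_above ((\<lambda>x. norm (\<phi> x)) ` {0..1})"
        by (intro bounded_imp_bdd_above compact_imp_bounded)
      then have "norm (?u \<phi>) \<le> B * (SUP x\<in>{0..1}. norm (\<phi> x))"
        unfolding f B_def by (intro dist_of_step_fun_bound[OF c] cSUP_upper) auto
      then show "norm (?u \<phi>) \<le> B * (\<Sum>j\<le>0. SUP x\<in>{0..1}. norm (iter_deriv j \<phi> x))" by simp
    qed
  qed
  moreover have "fourier_coeff ?u 0 = 0"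
  proof -
    have "fourier_coeff ?u 0 = (LINT x:{0..1}|lborel. complex_of_real (f x))"
      by (simp add: fourier_coeff_def dist_of_fun_def)
    also have "\<dots> = complex_of_real (LINT x:{0..1}|lborel. f x)"
      by (rule set_integral_complex_of_real)
    also have "(LINT x:{0..1}|lborel. f x)
        = (\<Sum>n=1..N. LINT x|lborel. v n * indicator (grid_interval h n \<inter> {0..1}) x)"
      unfolding set_lebesgue_integral_def f step_fun_def
      apply (subst Bochner_Integration.integral_sum[symmetric])
      subgoal
        by (intro integrable_mult_right integrable_real_indicator)
          (auto intro: le_less_trans[OF emeasure_mono[of _ "{0..1::real}"]])
      subgoal
        by (intro Bochner_Integration.integral_cong refl)
          (auto simp: sum_distrib_left indicator_def intro!: sum.cong)
      done
    also have "\<dots> = (\<Sum>n=1..N. v n * h)"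
      using measure_grid_interval[OF assms(1,2)] by (intro sum.cong) auto
    also have "\<dots> = 0" using v by (simp add: sum_distrib_right[symmetric])
    finally show ?thesis by simp
  qed
  moreover have "(\<lambda>\<xi>. (norm (fourier_coeff ?u \<xi>))\<^sup>2 / (real_of_int \<xi>)\<^sup>2) summable_on (UNIV - {0})"
  proof (rule summable_on_comparison_test)
    define g where "g = (\<lambda>\<xi>::int. B\<^sup>2 / (real_of_int \<xi>)\<^sup>2)"
    have gn: "(\<lambda>n. g (int (Suc n))) summable_on UNIV"
    proof (rule norm_summable_imp_summable_on)
      have "summable (\<lambda>n. B\<^sup>2 * inverse ((real (Suc n))\<^sup>2))"
        using inverse_power_summable[of 2, where 'a=real]
        by (intro summable_mult) (subst summable_Suc_iff, simp)
      then show "summable (\<lambda>n. norm (g (int (Suc n))))"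
        by (simp add: g_def divide_inverse)
    qed
    have pos: "g summable_on (range (\<lambda>n. int (Suc n)))"
      using gn by (subst summable_on_reindex) (simp_all add: inj_on_def o_def)
    have neg: "g summable_on (range (\<lambda>n. - int (Suc n)))"
    proof -
      have "g \<circ> (\<lambda>n. - int (Suc n)) = (\<lambda>n. g (int (Suc n)))"
        unfolding g_def o_def by (simp only: of_int_minus power2_minus)
      moreover have "inj (\<lambda>n. - int (Suc n))" by (rule injI) simp
      ultimately show ?thesis using gn by (simp only: summable_on_reindex)
    qed
    have disj: "range (\<lambda>n. int (Suc n)) \<inter> range (\<lambda>n. - int (Suc n)) = {}"
    proof -
      have "int (Suc m) \<noteq> - int (Suc n)" for m n by linarith
      then show ?thesis by blast
    qed
    have "range (\<lambda>n. int (Suc n)) \<union> range (\<lambda>n. - int (Suc n)) = UNIV - {0}"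
    proof (rule equalityI; rule subsetI)
      fix k :: int assume "k \<in> UNIV - {0}"
      then have "k = int (Suc (nat k - 1)) \<or> k = - int (Suc (nat (- k) - 1))"
        by (simp only: Diff_iff singleton_iff) linarith
      then show "k \<in> range (\<lambda>n. int (Suc n)) \<union> range (\<lambda>n. - int (Suc n))" by blast
    next
      fix k :: int assume "k \<in> range (\<lambda>n. int (Suc n)) \<union> range (\<lambda>n. - int (Suc n))"
      then obtain n where "k = int (Suc n) \<or> k = - int (Suc n)" by blast
      then have "k \<noteq> 0" by linarith
      then show "k \<in> UNIV - {0}" by simp
    qed
    with summable_on_Un_disjoint[OF pos neg disj]
    show "g summable_on (UNIV - {0})" by (simp only:)
    show "(norm (fourier_coeff ?u \<xi>))\<^sup>2 / (real_of_int \<xi>)\<^sup>2 \<le> g \<xi>" for \<xi>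
    proof -
      have "norm (fourier_coeff ?u \<xi>) \<le> B * 1"
        unfolding fourier_coeff_def f B_def
        by (intro dist_of_step_fun_bound) (auto intro!: continuous_intros)
      then show ?thesis unfolding g_def by (intro divide_right_mono power_mono) auto
    qed
  qed auto
  ultimately show ?thesis unfolding Hm1av_def by simp
qed

end

theory Submission
  imports Defs
begin

text \<open>Everything is computed in Fourier space.  Write \<open>z = e\<^sup>-\<^sup>2\<^sup>\<pi>\<^sup>i\<^sup>\<xi>\<^sup>/\<^sup>N\<close> and let \<open>W(z) = \<Sum>\<^sub>j w\<^sub>j z\<^sup>j\<close> be the
  discrete Fourier transform of \<open>w = S R A\<^sup>-\<^sup>1 v\<close>, so that \<open>H v = T w\<close>.

  By the definition of \<open>A\<close>, the vector \<open>w\<close> is a discrete antiderivative of \<open>v\<close>: it has sum zero and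
  \<open>S\<^sup>T w\<close> is the full vector of the \<open>N\<close> values of \<open>v\<^sub>h\<close>, the last one included
  (\<open>H_mat_mult_vec\<close>).  Hence the transform of the values of \<open>v\<^sub>h\<close> is \<open>W(z)\<close> times a factor of modulus
  \<open>\<bar>z - 1\<bar> = 2 \<bar>sin(\<pi>\<xi>/N)\<bar>\<close> (\<open>dft_transpose_S_mat\<close>).  Integrating over the cells contributes a
  further factor \<open>sin(\<pi>\<xi>/N) / (\<pi>\<xi>)\<close> (\<open>fourier_coeff_step_fun\<close>), and the squared norm becomes
  the sum over \<open>\<xi> \<noteq> 0\<close> of \<open>\<bar>W(z)\<bar>\<^sup>2 sin\<^sup>4(\<pi>\<xi>/N) / (\<pi>\<xi>)\<^sup>4\<close>.

  Since \<open>W(z)\<close> only depends on \<open>\<xi>\<close> modulo \<open>N\<close>, the frequencies are grouped into residue classes.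
  Over the class of \<open>r \<noteq> 0\<close> the weights have a closed form, because \<open>\<Sum>\<^sub>m (x + m)\<^sup>-\<^sup>4\<close> is an elementary
  function of \<open>sin(\<pi>x)\<close> (\<open>has_sum_inverse_fourth_powers\<close>, obtained by differentiating the reflection
  formula of the Gamma function four times): they add up to
  \<open>N\<^sup>-\<^sup>4 (1 - 2/3 sin\<^sup>2(\<pi>r/N))\<close>.  The entries \<open>a, b\<close> of the circulant matrix \<open>T\<close> satisfy \<open>a + b = 1\<close>
  and \<open>4ab = 2/3\<close>, which makes this factor exactly \<open>N\<^sup>-\<^sup>4 \<bar>a + b z\<bar>\<^sup>2\<close>, the squared modulus of the symbol of
  \<open>T\<close>.  What remains is \<open>N\<^sup>-\<^sup>4\<close> times the sum over \<open>r\<close> of the squared moduli of the transform of \<open>T w\<close>,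
  and the discrete Parseval identity turns it into \<open>N\<^sup>-\<^sup>3\<close> times the squared Euclidean norm of \<open>T w\<close>,
  which is the claim with \<open>h = 1/N\<close>.\<close>

section \<open>The lattice sum of inverse fourth powers\<close>

lemma Gamma_reflection_real:
  "Gamma x * Gamma (1 - x) = pi / sin (pi * x)" for x :: real
proof -
  have "complex_of_real (Gamma x * Gamma (1 - x)) = complex_of_real (pi / sin (pi * x))"
    using Gamma_reflection_complex[of "complex_of_real x"]
    by (simp flip: Gamma_complex_of_real sin_of_real)
  then show ?thesis by (simp only: of_real_eq_iff)
qed

lemma eq_on_unit_interval_imp_deriv_eq:
  fixes f g :: "real \<Rightarrow> real"
  assumes "\<And>x. 0 < x \<Longrightarrow> x < 1 \<Longrightarrow> f x = g x"
    and "0 < x" "x < 1" "(f has_field_derivative f') (at x)" "(g has_field_derivative g') (at x)"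
  shows "f' = g'"
proof -
  have "(g has_field_derivative f') (at x)"
    using assms by (intro has_field_derivative_transform_within_open[of f f' x "{0<..<1}" g]) auto
  with assms(5) show ?thesis by (rule DERIV_unique[rotated])
qed

lemma not_nonpos_Int: "0 < x \<Longrightarrow> (x::real) \<notin> \<int>\<^sub>\<le>\<^sub>0"
  using nonpos_Ints_nonpos by fastforce

lemma sin_pi_pos: "0 < x \<Longrightarrow> x < 1 \<Longrightarrow> 0 < sin (pi * x)" for x :: real
  by (intro sin_gt_zero) simp_all

text \<open>The logarithmic derivative of the reflection formula of the Gamma function.\<close>

lemma Digamma_reflection_real:
  fixes x :: real
  assumes x: "0 < x" "x < 1"
  shows "Digamma (1 - x) - Digamma x = pi * cos (pi * x) / sin (pi * x)"
proof -
  note [simp] = not_nonpos_Int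
  have s: "sin (pi * x) > 0" using x by (rule sin_pi_pos)
  have "Gamma x * Gamma (1 - x) * (Digamma x - Digamma (1 - x))
      = - (pi / sin (pi * x)) * (pi * cos (pi * x) / sin (pi * x))"
  proof (rule eq_on_unit_interval_imp_deriv_eq[OF _ x])
    show "Gamma y * Gamma (1 - y) = pi / sin (pi * y)" for y by (rule Gamma_reflection_real)
    show "((\<lambda>y. Gamma y * Gamma (1 - y)) has_field_derivative
        Gamma x * Gamma (1 - x) * (Digamma x - Digamma (1 - x))) (at x)"
      using x by (auto intro!: derivative_eq_intros simp: algebra_simps)
    show "((\<lambda>y. pi / sin (pi * y)) has_field_derivative
        - (pi / sin (pi * x)) * (pi * cos (pi * x) / sin (pi * x))) (at x)"
      using s by (auto intro!: derivative_eq_intros simp: field_simps)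
  qed
  then have "pi / sin (pi * x) * (Digamma x - Digamma (1 - x) + pi * cos (pi * x) / sin (pi * x)) = 0"
    unfolding Gamma_reflection_real by (simp only: distrib_left)
  then show ?thesis using s by simp
qed

text \<open>The reflection formula of the Digamma function, differentiated three times.\<close>

lemma Polygamma_3_reflection_real:
  fixes x :: real
  assumes x: "0 < x" "x < 1"
  shows "Polygamma 3 x + Polygamma 3 (1 - x)
       = pi ^ 4 * (6 / sin (pi * x) ^ 4 - 4 / sin (pi * x) ^ 2)"
proof -
  note [simp] = not_nonpos_Int
  have 1: "Polygamma 1 x + Polygamma 1 (1 - x) = pi\<^sup>2 / sin (pi * x) ^ 2" if x: "0 < x" "x < 1" for x :: real
  proof -
    have s: "sin (pi * x) \<noteq> 0" using sin_pi_pos[OF x] by simp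
    have "- Polygamma 1 (1 - x) - Polygamma 1 x = - (pi\<^sup>2 / sin (pi * x) ^ 2)"
    proof (rule eq_on_unit_interval_imp_deriv_eq[OF Digamma_reflection_real x])
      show "((\<lambda>y. Digamma (1 - y) - Digamma y) has_field_derivative
          - Polygamma 1 (1 - x) - Polygamma 1 x) (at x)"
        using x by (auto intro!: derivative_eq_intros)
      have "((\<lambda>y. pi * cos (pi * y) / sin (pi * y)) has_field_derivative
          - pi\<^sup>2 - pi\<^sup>2 * cos (pi * x) ^ 2 / sin (pi * x) ^ 2) (at x)"
        using s by (auto intro!: derivative_eq_intros simp: field_simps power2_eq_square)
      also have "- pi\<^sup>2 - pi\<^sup>2 * cos (pi * x) ^ 2 / sin (pi * x) ^ 2 = - (pi\<^sup>2 / sin (pi * x) ^ 2)"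
        using s unfolding cos_squared_eq by (simp add: field_simps)
      finally show "((\<lambda>y. pi * cos (pi * y) / sin (pi * y)) has_field_derivative
          - (pi\<^sup>2 / sin (pi * x) ^ 2)) (at x)" .
    qed
    then show ?thesis by simp
  qed
  have 2: "Polygamma 2 x - Polygamma 2 (1 - x) = - 2 * pi ^ 3 * cos (pi * x) / sin (pi * x) ^ 3"
    if x: "0 < x" "x < 1" for x :: real
  proof (rule eq_on_unit_interval_imp_deriv_eq[OF 1 x])
    have s: "sin (pi * x) \<noteq> 0" using sin_pi_pos[OF x] by simp
    show "((\<lambda>y. Polygamma 1 y + Polygamma 1 (1 - y)) has_field_derivative
        Polygamma 2 x - Polygamma 2 (1 - x)) (at x)"
      using x by (auto intro!: derivative_eq_intros simp: numeral_2_eq_2)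
    show "((\<lambda>y. pi\<^sup>2 / sin (pi * y) ^ 2) has_field_derivative
        - 2 * pi ^ 3 * cos (pi * x) / sin (pi * x) ^ 3) (at x)"
      using s by (auto intro!: derivative_eq_intros simp: field_simps power2_eq_square power3_eq_cube)
  qed
  show ?thesis
  proof (rule eq_on_unit_interval_imp_deriv_eq[OF 2 x])
    have s: "sin (pi * x) \<noteq> 0" using sin_pi_pos[OF x] by simp
    show "((\<lambda>y. Polygamma 2 y - Polygamma 2 (1 - y)) has_field_derivative
        Polygamma 3 x + Polygamma 3 (1 - x)) (at x)"
      using x by (auto intro!: derivative_eq_intros simp: eval_nat_numeral)
    have "((\<lambda>y. - 2 * pi ^ 3 * cos (pi * y) / sin (pi * y) ^ 3) has_field_derivative
       2 * pi ^ 4 * (sin (pi * x) ^ 2 + 3 * cos (pi * x) ^ 2) / sin (pi * x) ^ 4) (at x)"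
      using s by (auto intro!: derivative_eq_intros simp: divide_simps) (simp add: algebra_simps eval_nat_numeral)
    also have "2 * pi ^ 4 * (sin (pi * x) ^ 2 + 3 * cos (pi * x) ^ 2) / sin (pi * x) ^ 4
       = pi ^ 4 * (6 / sin (pi * x) ^ 4 - 4 / sin (pi * x) ^ 2)"
      using s unfolding cos_squared_eq by (simp add: field_simps eval_nat_numeral)
    finally show "((\<lambda>y. - 2 * pi ^ 3 * cos (pi * y) / sin (pi * y) ^ 3) has_field_derivative
        pi ^ 4 * (6 / sin (pi * x) ^ 4 - 4 / sin (pi * x) ^ 2)) (at x)" .
  qed
qed

text \<open>The terms with \<open>m \<ge> 0\<close> form the series of the Polygamma function of order 3 at \<open>x\<close>, those with
  \<open>m < 0\<close> the one at \<open>1 - x\<close>, so the reflection formula evaluates the whole sum.\<close>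

lemma has_sum_inverse_fourth_powers:
  fixes x :: real
  assumes x: "0 < x" "x < 1"
  shows "((\<lambda>m::int. 1 / (x + of_int m) ^ 4) has_sum
     pi ^ 4 * (1 - 2 / 3 * sin (pi * x) ^ 2) / sin (pi * x) ^ 4) UNIV"
proof -
  let ?f = "\<lambda>m::int. 1 / (x + of_int m) ^ 4"
  have half: "((\<lambda>k. 1 / (y + real k) ^ 4) has_sum Polygamma 3 y / 6) UNIV" if "y > 0" for y :: real
    using Polygamma_LIMSEQ[of y 3] that
    by (intro sums_nonneg_imp_has_sum) (simp_all add: inverse_eq_divide fact_numeral)
  have pos: "(?f has_sum Polygamma 3 x / 6) (range int)"
    by (subst has_sum_reindex) (use half[of x] x in \<open>simp_all add: o_def\<close>)
  have neg: "(?f has_sum Polygamma 3 (1 - x) / 6) (range (\<lambda>k. - 1 - int k))"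
  proof (subst has_sum_reindex)
    have "(x + of_int (- 1 - int k)) ^ 4 = (1 - x + real k) ^ 4" for k
      using power_minus_even[of 4 "1 - x + real k"] by (simp add: algebra_simps)
    then show "(?f \<circ> (\<lambda>k. - 1 - int k) has_sum Polygamma 3 (1 - x) / 6) UNIV"
      using half[of "1 - x"] x by (simp only: o_def)
  qed (simp add: inj_on_def)
  have "m \<in> range int \<union> range (\<lambda>k. - 1 - int k)" for m
  proof (cases "m \<ge> 0")
    case True
    then show ?thesis by (intro UnI1 range_eqI[of _ _ "nat m"]) simp
  next
    case False
    then show ?thesis by (intro UnI2 range_eqI[of _ _ "nat (- 1 - m)"]) simp
  qed
  then have "range int \<union> range (\<lambda>k. - 1 - int k) = UNIV" by blast
  moreover have "range int \<inter> range (\<lambda>k. - 1 - int k) = {}" by auto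
  ultimately have "(?f has_sum Polygamma 3 x / 6 + Polygamma 3 (1 - x) / 6) UNIV"
    using has_sum_Un_disjoint[OF pos neg] by (simp only:)
  also have "Polygamma 3 x / 6 + Polygamma 3 (1 - x) / 6
      = pi ^ 4 * (1 - 2 / 3 * sin (pi * x) ^ 2) / sin (pi * x) ^ 4"
    using Polygamma_3_reflection_real[OF x] sin_pi_pos[OF x]
    by (simp add: add_divide_distrib[symmetric] field_simps eval_nat_numeral)
  finally show ?thesis .
qed

section \<open>The discrete Fourier transform\<close>

definition unity_root :: "nat \<Rightarrow> int \<Rightarrow> complex" where
  "unity_root N \<xi> = cis (- (2 * pi * of_int \<xi> / real N))"

definition dft :: "nat \<Rightarrow> (nat \<Rightarrow> real) \<Rightarrow> complex \<Rightarrow> complex" where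
  "dft N w z = (\<Sum>j<N. of_real (w j) * z ^ j)"

lemma unity_root_power: "unity_root N \<xi> ^ j = cis (- (2 * pi * (of_int \<xi> * real j / real N)))"
  by (simp add: unity_root_def Complex.DeMoivre mult_ac)

lemma unity_root_power_N: "N > 0 \<Longrightarrow> unity_root N \<xi> ^ N = 1"
  using cis_multiple_2pi[of "- of_int \<xi>"] by (simp add: unity_root_power)

lemma unity_root_add_multiple:
  assumes "N > 0" shows "unity_root N (\<xi> + m * int N) = unity_root N \<xi>"
proof -
  have "unity_root N (\<xi> + m * int N) = unity_root N \<xi> * cis (2 * pi * (- of_int m))"
    unfolding unity_root_def cis_mult using assms
    by (intro arg_cong[of _ _ cis]) (simp add: field_simps)
  then show ?thesis by (subst (asm) cis_multiple_2pi) auto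
qed

text \<open>Orthogonality of the characters of the cyclic group of order \<open>N\<close>: a geometric sum whose
  ratio is an \<open>N\<close>-th root of unity, different from 1 when \<open>j \<noteq> k\<close>.\<close>

lemma sum_unity_roots:
  assumes "j < N" "k < N"
  shows "(\<Sum>r<N. unity_root N (int r) ^ j * cnj (unity_root N (int r) ^ k)) = (if j = k then of_nat N else 0)"
proof -
  define q where "q = cis (2 * pi * ((real k - real j) / real N))"
  have "unity_root N (int r) ^ j * cnj (unity_root N (int r) ^ k) = q ^ r" for r
    unfolding unity_root_power cis_cnj cis_mult q_def Complex.DeMoivre
    by (rule arg_cong[of _ _ cis]) (simp add: algebra_simps diff_divide_distrib)
  then have eq: "(\<Sum>r<N. unity_root N (int r) ^ j * cnj (unity_root N (int r) ^ k)) = (\<Sum>r<N. q ^ r)"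
    by simp
  show ?thesis
  proof (cases "j = k")
    case True
    then show ?thesis unfolding eq by (simp add: q_def)
  next
    case False
    have "q \<noteq> 1"
    proof
      assume "q = 1"
      then have "cos (2 * pi * ((real k - real j) / real N)) = 1"
        by (simp add: q_def complex_eq_iff)
      then obtain n :: int where "2 * pi * ((real k - real j) / real N) = of_int n * 2 * pi"
        by (auto simp: cos_one_2pi_int)
      then have "2 * pi * ((real k - real j) / real N) = 2 * pi * of_int n"
        by (simp only: mult_ac)
      then have "(real k - real j) / real N = of_int n"
        by (subst (asm) mult_cancel_left) simp
      then have "real k - real j = of_int n * real N"
        using assms by (simp add: field_simps)
      then have "real_of_int (int k - int j) = real_of_int (n * int N)" by simp
      then have n: "int k - int j = n * int N" by (simp only: of_int_eq_iff)
      then have "int N dvd int k - int j" by simp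
      then have "int N \<le> \<bar>int k - int j\<bar>" using False by (intro zdvd_imp_le) (auto simp: dvd_abs_iff)
      then show False using assms by linarith
    qed
    moreover have "q ^ N = 1"
      using cis_multiple_2pi[of "of_int (int k - int j)"] assms by (simp add: q_def Complex.DeMoivre)
    ultimately show ?thesis unfolding eq using False by (simp add: geometric_sum)
  qed
qed

lemma dft_Parseval:
  "(\<Sum>r<N. (norm (dft N w (unity_root N (int r))))\<^sup>2) = real N * (\<Sum>j<N. (w j)\<^sup>2)"
proof -
  let ?z = "\<lambda>r. unity_root N (int r)"
  have "complex_of_real (\<Sum>r<N. (norm (dft N w (?z r)))\<^sup>2)
      = (\<Sum>r<N. \<Sum>j<N. \<Sum>k<N. of_real (w j) * of_real (w k) * (?z r ^ j * cnj (?z r ^ k)))"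
    unfolding of_real_sum complex_norm_square dft_def cnj_sum sum_product
    by (intro sum.cong refl) (simp add: mult_ac)
  also have "\<dots> = (\<Sum>j<N. \<Sum>r<N. \<Sum>k<N. of_real (w j) * of_real (w k) * (?z r ^ j * cnj (?z r ^ k)))"
    by (rule sum.swap)
  also have "\<dots> = (\<Sum>j<N. \<Sum>k<N. \<Sum>r<N. of_real (w j) * of_real (w k) * (?z r ^ j * cnj (?z r ^ k)))"
    by (intro sum.cong refl sum.swap)
  also have "\<dots> = (\<Sum>j<N. \<Sum>k<N. of_real (w j) * of_real (w k) * (if j = k then of_nat N else 0))"
    by (intro sum.cong refl) (simp only: sum_distrib_left[symmetric] sum_unity_roots lessThan_iff)
  also have "\<dots> = complex_of_real (real N * (\<Sum>j<N. (w j)\<^sup>2))"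
    by (simp add: sum_distrib_left power2_eq_square mult_ac if_distrib cong: if_cong)
  finally show ?thesis by (simp only: of_real_eq_iff)
qed

lemma cyc_pred_bij: "bij_betw (cyc_pred N) {..<N} {..<N}"
  by (rule bij_betw_byWitness[where f' = "\<lambda>i. if i = N - 1 then 0 else Suc i"])
    (auto simp: cyc_pred_def split: if_splits)

lemma power_cyc_pred:
  fixes z :: complex
  assumes "z ^ N = 1" "j < N" shows "z * z ^ cyc_pred N j = z ^ j"
  using assms by (cases j) (auto simp: cyc_pred_def power_Suc[symmetric] simp del: power_Suc)

lemma dft_shift:
  assumes "z ^ N = 1"
  shows "dft N (\<lambda>j. w (cyc_pred N j)) z = z * dft N w z"
proof -
  have "dft N (\<lambda>j. w (cyc_pred N j)) z
      = (\<Sum>j<N. z * (of_real (w (cyc_pred N j)) * z ^ cyc_pred N j))"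
    unfolding dft_def
    by (intro sum.cong refl) (simp flip: power_cyc_pred[OF assms])
  also have "\<dots> = (\<Sum>j<N. z * (of_real (w j) * z ^ j))"
    by (rule sum.reindex_bij_betw[OF cyc_pred_bij])
  finally show ?thesis by (simp add: dft_def sum_distrib_left)
qed

lemma dft_linear: "dft N (\<lambda>j. c * u j + d * w j) z = of_real c * dft N u z + of_real d * dft N w z"
  by (simp add: dft_def sum_distrib_left sum.distrib algebra_simps)

section \<open>Fourier coefficients of step functions\<close>

lemma set_integral_Ico_FTC:
  fixes F f :: "real \<Rightarrow> complex"
  assumes "a \<le> b" "\<And>x. (F has_vector_derivative f x) (at x)" "continuous_on UNIV f"
  shows "(LINT x:{a..<b}|lborel. f x) = F b - F a"
    and "(LINT x:{a..b}|lborel. f x) = F b - F a"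
proof -
  have "(LBINT x=a..b. f x) = F b - F a"
    using assms by (intro interval_integral_FTC_finite)
      (auto intro: continuous_on_subset has_vector_derivative_at_within)
  then show "(LINT x:{a..<b}|lborel. f x) = F b - F a" "(LINT x:{a..b}|lborel. f x) = F b - F a"
    using interval_integral_Ico[OF assms(1), of f] interval_integral_Icc[OF assms(1), of f] by simp_all
qed

text \<open>In the period \<open>[0, 1]\<close> every cell but the last is a single interval; the last one is centred
  at the point 0 of the torus and splits into two pieces.\<close>

lemma grid_interval_inner:
  assumes "N \<ge> 3" "h = 1 / real N" "n \<in> {1..<N}"
  shows "grid_interval h n \<inter> {0..1} = {(real n - 1/2) * h ..< (real n + 1/2) * h}"
proof -
  have h: "h > 0" and Nh: "real N * h = 1" using assms by simp_all
  have lo: "(real n - 1/2) * h > 0" using assms h by simp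
  have "(real n + 1/2) * h < real N * h"
    using assms h by (intro mult_strict_right_mono) auto
  then have hi: "(real n + 1/2) * h < 1" using Nh by simp
  show ?thesis
  proof (intro Set.set_eqI iffI)
    fix x assume "x \<in> grid_interval h n \<inter> {0..1}"
    then obtain k :: int where x: "0 \<le> x" "x \<le> 1"
      "(real n - 1/2) * h \<le> x + of_int k" "x + of_int k < (real n + 1/2) * h"
      by (auto simp: grid_interval_def)
    have "of_int k < (1::real)" "of_int k > (-1::real)" using x lo hi by linarith+
    then have "k = 0" by linarith
    then show "x \<in> {(real n - 1/2) * h ..< (real n + 1/2) * h}" using x by simp
  next
    fix x assume x: "x \<in> {(real n - 1/2) * h ..< (real n + 1/2) * h}"
    then have "0 \<le> x" "x \<le> 1" using lo hi by (simp_all only: atLeastLessThan_iff) linarith+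
    with x show "x \<in> grid_interval h n \<inter> {0..1}"
      by (auto simp: grid_interval_def intro!: exI[of _ "0::int"])
  qed
qed

lemma grid_interval_last:
  assumes "N \<ge> 3" "h = 1 / real N"
  shows "grid_interval h N \<inter> {0..1} = {0..<h/2} \<union> {1 - h/2..1}"
proof -
  have h: "h > 0" "h \<le> 1/3" using assms(1) unfolding assms(2) by (simp_all add: frac_le)
  have e: "(real N - 1/2) * h = 1 - h/2" "(real N + 1/2) * h = 1 + h/2"
    using assms by (simp_all add: field_simps)
  show ?thesis
  proof (intro Set.set_eqI iffI)
    fix x assume "x \<in> grid_interval h N \<inter> {0..1}"
    then obtain k :: int where x: "0 \<le> x" "x \<le> 1"
      "1 - h/2 \<le> x + of_int k" "x + of_int k < 1 + h/2"
      unfolding grid_interval_def e by auto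
    have "of_int k < (2::real)" "of_int k > (-1::real)" using x h by linarith+
    then have "k = 0 \<or> k = 1" by linarith
    then show "x \<in> {0..<h/2} \<union> {1 - h/2..1}" using x by auto
  next
    fix x assume "x \<in> {0..<h/2} \<union> {1 - h/2..1}"
    then show "x \<in> grid_interval h N \<inter> {0..1}"
      unfolding grid_interval_def e using h
      by (auto intro: exI[of _ "0::int"] exI[of _ "1::int"])
  qed
qed

lemma continuous_set_integrable:
  fixes f :: "real \<Rightarrow> complex"
  assumes "continuous_on UNIV f" "A \<in> sets borel" "A \<subseteq> {0..1}"
  shows "set_integrable lborel A f"
proof (rule set_integrable_subset[of _ "{0..1}"])
  show "set_integrable lborel {0..1} f"
    unfolding set_integrable_def
    by (intro borel_integrable_compact continuous_on_subset[OF assms(1)]) auto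
qed (use assms in auto)

text \<open>Periodicity of the antiderivative hides the split of the last cell: its two boundary terms at 0
  and 1 cancel, and the formula is the same for all cells.\<close>

lemma grid_interval_integral:
  fixes F f :: "real \<Rightarrow> complex"
  assumes N: "N \<ge> 3" "h = 1 / real N" and n: "n \<in> {1..N}"
    and F: "\<And>x. (F has_vector_derivative f x) (at x)" "continuous_on UNIV f" "periodic1 F"
  shows "(LINT x:grid_interval h n \<inter> {0..1}|lborel. f x) = F ((real n + 1/2) * h) - F ((real n - 1/2) * h)"
proof (cases "n = N")
  case False
  then have n: "n \<in> {1..<N}" using n by auto
  have "(real n - 1/2) * h \<le> (real n + 1/2) * h" using N by (intro mult_right_mono) auto
  then show ?thesis
    unfolding grid_interval_inner[OF N n] by (intro set_integral_Ico_FTC F)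
next
  case True
  have h: "h > 0" "h \<le> 1/3" using N(1) unfolding N(2) by (simp_all add: frac_le)
  have e: "(real N - 1/2) * h = 1 - h/2" "(real N + 1/2) * h = h/2 + 1"
    using N by (simp_all add: field_simps)
  have p: "F (x + 1) = F x" for x using F(3) by (simp add: periodic1_def)
  have "(LINT x:grid_interval h n \<inter> {0..1}|lborel. f x)
      = (LINT x:{0..<h/2}|lborel. f x) + (LINT x:{1 - h/2..1}|lborel. f x)"
    unfolding True grid_interval_last[OF N] using h
    by (intro set_integral_Un continuous_set_integrable F) auto
  also have "\<dots> = (F (h/2) - F 0) + (F 1 - F (1 - h/2))"
    using h by (simp add: set_integral_Ico_FTC[OF _ F(1,2)])
  also have "\<dots> = F (h/2 + 1) - F (1 - h/2)"
    using p[of 0] p[of "h/2"] by simp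
  finally show ?thesis unfolding True e .
qed

text \<open>The prefactor \<open>unity_root N \<xi>\<close> has modulus 1; it is there because the cells are numbered from
  1 and the transform from 0.\<close>

lemma fourier_coeff_step_fun:
  assumes N: "N \<ge> 3" "h = 1 / real N" and \<xi>: "\<xi> \<noteq> 0"
  shows "fourier_coeff (dist_of_fun (step_fun N h v)) \<xi>
       = unity_root N \<xi> * dft N (\<lambda>i. v (i + 1)) (unity_root N \<xi>)
           * of_real (sin (pi * (of_int \<xi> / N)) / (pi * of_int \<xi>))"
proof -
  define f where "f x = cis (- (2 * pi * of_int \<xi> * x))" for x
  define F where "F x = f x / (- (2 * pi * \<i> * of_int \<xi>))" for x
  have f_exp: "f x = exp (- 2 * of_real pi * \<i> * of_int \<xi> * of_real x)" for x
    by (simp add: f_def cis_conv_exp mult_ac)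
  have F: "(F has_vector_derivative f x) (at x)" for x
    unfolding F_def f_exp using \<xi>
    by (auto intro!: derivative_eq_intros has_vector_derivative_real_field simp: field_simps)
  have cont: "continuous_on UNIV f" unfolding f_exp by (intro continuous_intros)
  have "f (x + 1) = f x" for x
  proof -
    have "f (x + 1) = f x * cis (2 * pi * (- of_int \<xi>))"
      unfolding f_def cis_mult by (rule arg_cong[of _ _ cis]) (simp add: algebra_simps)
    then show ?thesis by (subst (asm) cis_multiple_2pi) auto
  qed
  then have per: "periodic1 F" by (simp add: periodic1_def F_def)
  have int: "integrable lborel
      (\<lambda>x. complex_of_real (v n) * (indicat_real (grid_interval h n \<inter> {0..1}) x *\<^sub>R f x))" for n
    using continuous_set_integrable[OF cont, of "grid_interval h n \<inter> {0..1}"]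
    unfolding set_integrable_def by (intro integrable_mult_right) simp
  have "fourier_coeff (dist_of_fun (step_fun N h v)) \<xi> = (LINT x:{0..1}|lborel. of_real (step_fun N h v x) * f x)"
    by (simp add: fourier_coeff_def dist_of_fun_def f_exp)
  also have "\<dots> = (LINT x|lborel. (\<Sum>n=1..N. of_real (v n) * (indicat_real (grid_interval h n \<inter> {0..1}) x *\<^sub>R f x)))"
    unfolding set_lebesgue_integral_def step_fun_def of_real_sum sum_distrib_right scaleR_sum_right
    by (intro Bochner_Integration.integral_cong refl sum.cong)
      (simp add: indicator_inter_arith scaleR_conv_of_real mult_ac)
  also have "\<dots> = (\<Sum>n=1..N. of_real (v n) * (LINT x:grid_interval h n \<inter> {0..1}|lborel. f x))"
    unfolding set_lebesgue_integral_def
    by (simp only: Bochner_Integration.integral_sum[OF int] integral_mult_right_zero)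
  also have "\<dots> = (\<Sum>n=1..N. of_real (v n) * (unity_root N \<xi> ^ n * of_real (sin (pi * (of_int \<xi> / N)) / (pi * of_int \<xi>))))"
  proof (intro sum.cong refl arg_cong2[of _ _ _ _ "(*)"])
    fix n assume n: "n \<in> {1..N}"
    have "F ((real n + 1/2) * h) - F ((real n - 1/2) * h)
       = unity_root N \<xi> ^ n * (cis (- (pi * (of_int \<xi> / N))) - cis (pi * (of_int \<xi> / N))) / (- (2 * pi * \<i> * of_int \<xi>))"
      unfolding F_def f_def unity_root_power diff_divide_distrib[symmetric] right_diff_distrib cis_mult N(2)
      using N(1) by (intro arg_cong2[of _ _ _ _ "(/)"] arg_cong2[of _ _ _ _ "(-)"] arg_cong[of _ _ cis] refl)
        (simp_all add: field_simps)
    also have "cis (- a) - cis a = - (2 * \<i> * sin a)" for a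
      by (simp add: complex_eq_iff)
    finally show "(LINT x:grid_interval h n \<inter> {0..1}|lborel. f x)
        = unity_root N \<xi> ^ n
           * of_real (sin (pi * (of_int \<xi> / N)) / (pi * of_int \<xi>))"
      unfolding grid_interval_integral[OF N n F cont per] using \<xi> by (simp add: field_simps)
  qed
  also have "\<dots> = unity_root N \<xi> * dft N (\<lambda>i. v (i + 1)) (unity_root N \<xi>)
           * of_real (sin (pi * (of_int \<xi> / N)) / (pi * of_int \<xi>))"
    unfolding dft_def sum_distrib_left sum_distrib_right
    unfolding One_nat_def sum.atLeast1_atMost_eq
    by (intro sum.cong refl) (simp add: mult_ac)
  finally show ?thesis .
qed

section \<open>The weights on a residue class\<close>

text \<open>A circulant matrix with entries \<open>a\<close> on the diagonal and \<open>b\<close> on the cyclic subdiagonal acts on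
  the transform as multiplication by \<open>a + b z\<close>.  The case \<open>a, b = \<plusminus>1\<close> is the difference
  operator, the other case of interest is \<open>T\<close>.\<close>

lemma norm_circulant_symbol:
  "(norm (of_real a + of_real b * unity_root N \<xi>))\<^sup>2
     = (a + b)\<^sup>2 - 4 * a * b * (sin (pi * (of_int \<xi> / real N)))\<^sup>2"
proof -
  define t where "t = pi * (of_int \<xi> / real N)"
  have z: "unity_root N \<xi> = cis (- (2 * t))" by (simp add: unity_root_def t_def mult_ac)
  have expand: "(a + b * c)\<^sup>2 + (b * s)\<^sup>2 = a\<^sup>2 + b\<^sup>2 * (c\<^sup>2 + s\<^sup>2) + 2 * a * b * c" for c s :: real
    by (simp add: power2_eq_square algebra_simps)
  have "(norm (of_real a + of_real b * unity_root N \<xi>))\<^sup>2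
      = (a + b * cos (2 * t))\<^sup>2 + (b * sin (2 * t))\<^sup>2"
    unfolding z cmod_power2 by simp
  also have "\<dots> = a\<^sup>2 + b\<^sup>2 * ((cos (2 * t))\<^sup>2 + (sin (2 * t))\<^sup>2) + 2 * a * b * cos (2 * t)"
    by (rule expand)
  also have "\<dots> = (a + b)\<^sup>2 - 4 * a * b * (sin t)\<^sup>2"
    unfolding sin_cos_squared_add2 unfolding cos_double_sin by (simp add: power2_eq_square algebra_simps)
  finally show ?thesis unfolding t_def .
qed

lemma sin_squared_add_multiple:
  assumes "N > 0"
  shows "(sin (pi * (of_int (\<xi> + m * int N) / real N)))\<^sup>2 = (sin (pi * (of_int \<xi> / real N)))\<^sup>2"
  using norm_circulant_symbol[of 1 "-1" N "\<xi> + m * int N"] norm_circulant_symbol[of 1 "-1" N \<xi>]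
  unfolding unity_root_add_multiple[OF assms] by simp

definition T_apply :: "nat \<Rightarrow> (nat \<Rightarrow> real) \<Rightarrow> nat \<Rightarrow> real" where
  "T_apply N w i = (sqrt 3 + 1) / (2 * sqrt 3) * w i + (sqrt 3 - 1) / (2 * sqrt 3) * w (cyc_pred N i)"

text \<open>This is where the particular entries \<open>a, b\<close> of \<open>T\<close> enter: they solve \<open>a + b = 1\<close> and
  \<open>4ab = 2/3\<close>, so that the symbol of \<open>T\<close> reproduces the factor in
  \<open>has_sum_inverse_fourth_powers\<close>.\<close>

lemma norm_dft_T_apply:
  assumes "N > 0"
  shows "(norm (dft N (T_apply N w) (unity_root N \<xi>)))\<^sup>2
    = (1 - 2 / 3 * (sin (pi * (of_int \<xi> / real N)))\<^sup>2) * (norm (dft N w (unity_root N \<xi>)))\<^sup>2"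
proof -
  define a b where "a = (sqrt 3 + 1) / (2 * sqrt 3)" and "b = (sqrt 3 - 1) / (2 * sqrt 3)"
  have ab: "a + b = 1" "4 * a * b = 2 / 3"
    by (simp_all add: a_def b_def field_simps)
  have "dft N (T_apply N w) (unity_root N \<xi>)
      = (of_real a + of_real b * unity_root N \<xi>) * dft N w (unity_root N \<xi>)"
    unfolding T_apply_def[abs_def] a_def[symmetric] b_def[symmetric] dft_linear
      dft_shift[OF unity_root_power_N[OF assms]]
    by (simp add: algebra_simps)
  then show ?thesis
    by (simp only: norm_mult power_mult_distrib norm_circulant_symbol ab power_one)
qed

lemma has_sum_residue_class:
  assumes "0 < r" "r < N"
  shows "((\<lambda>m::int. sin (pi * (of_int (int r + m * int N) / real N)) ^ 4 / (pi * of_int (int r + m * int N)) ^ 4)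
     has_sum (1 - 2 / 3 * (sin (pi * (real r / real N)))\<^sup>2) / real N ^ 4) UNIV"
proof -
  define x where "x = real r / real N"
  have x: "0 < x" "x < 1" using assms by (simp_all add: x_def)
  have N: "N > 0" using assms by simp
  have s: "sin (pi * x) \<noteq> 0" using sin_pi_pos[OF x] by simp
  have "sin (pi * x) ^ 4 / (pi ^ 4 * real N ^ 4) * (1 / (x + of_int m) ^ 4) =
     sin (pi * (of_int (int r + m * int N) / real N)) ^ 4 / (pi * of_int (int r + m * int N)) ^ 4" for m
  proof -
    have s: "sin (pi * (of_int (int r + m * int N) / real N)) ^ 4 = sin (pi * x) ^ 4"
      using arg_cong[OF sin_squared_add_multiple[OF N, of "int r" m], of "\<lambda>t. t ^ 2"]
      unfolding power_mult[symmetric] by (simp add: x_def)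
    have e: "of_int (int r + m * int N) = real N * (x + of_int m)"
      using N by (simp add: x_def field_simps)
    show ?thesis unfolding s unfolding e power_mult_distrib by (simp add: mult_ac)
  qed
  moreover have "((\<lambda>m::int. sin (pi * x) ^ 4 / (pi ^ 4 * real N ^ 4) * (1 / (x + of_int m) ^ 4)) has_sum
      sin (pi * x) ^ 4 / (pi ^ 4 * real N ^ 4) * (pi ^ 4 * (1 - 2 / 3 * sin (pi * x) ^ 2) / sin (pi * x) ^ 4)) UNIV"
    by (rule has_sum_cmult_right[OF has_sum_inverse_fourth_powers[OF x]])
  moreover have "sin (pi * x) ^ 4 / (pi ^ 4 * real N ^ 4) * (pi ^ 4 * (1 - 2 / 3 * sin (pi * x) ^ 2) / sin (pi * x) ^ 4)
      = (1 - 2 / 3 * (sin (pi * x))\<^sup>2) / real N ^ 4"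
    using s by simp
  ultimately show ?thesis unfolding x_def by simp
qed

lemma has_sum_int_residue_classes:
  fixes f :: "int \<Rightarrow> 'a :: topological_comm_monoid_add"
  assumes "N > 0" "\<And>r. r < N \<Longrightarrow> ((\<lambda>m. f (int r + m * int N)) has_sum c r) UNIV"
  shows "(f has_sum (\<Sum>r<N. c r)) UNIV"
proof -
  have "(f has_sum (\<Sum>r<N. c r)) (\<Union>r<N. range (\<lambda>m. int r + m * int N))"
  proof (rule sum_has_sum)
    show "(f has_sum c r) (range (\<lambda>m. int r + m * int N))" if "r \<in> {..<N}" for r
      using assms that by (subst has_sum_reindex) (auto simp: inj_on_def o_def)
    show "range (\<lambda>m. int r + m * int N) \<inter> range (\<lambda>m. int s + m * int N) = {}"
      if "r \<in> {..<N}" "s \<in> {..<N}" "r \<noteq> s" for r s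
    proof -
      have "int r + m * int N \<noteq> int s + k * int N" for m k
      proof
        assume "int r + m * int N = int s + k * int N"
        then have "(int r + m * int N) mod int N = (int s + k * int N) mod int N" by simp
        then show False using that by simp
      qed
      then show ?thesis by blast
    qed
  qed simp
  moreover have "\<xi> \<in> (\<Union>r<N. range (\<lambda>m. int r + m * int N))" for \<xi>
  proof -
    have "\<xi> = int (nat (\<xi> mod int N)) + (\<xi> div int N) * int N" "nat (\<xi> mod int N) < N"
      using assms(1) by (simp_all add: nat_less_iff)
    then show ?thesis by blast
  qed
  then have "(\<Union>r<N. range (\<lambda>m. int r + m * int N)) = UNIV" by blast
  ultimately show ?thesis by simp
qed

text \<open>The term \<open>\<xi> = 0\<close> is 0 because division by zero yields 0, which allows summing over all integers.
  The whole residue class of 0 contributes nothing, as the transform of \<open>w\<close> vanishes there; it is the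
  only class on which \<open>has_sum_residue_class\<close> has nothing to say.\<close>

lemma has_sum_weighted_dft:
  assumes N: "N > 0" and w: "(\<Sum>j<N. w j) = 0"
  shows "((\<lambda>\<xi>. (norm (dft N w (unity_root N \<xi>)))\<^sup>2 * (sin (pi * (of_int \<xi> / real N)) ^ 4 / (pi * of_int \<xi>) ^ 4))
     has_sum (\<Sum>i<N. (T_apply N w i)\<^sup>2) / real N ^ 3) UNIV"
proof -
  let ?W = "\<lambda>\<xi>. (norm (dft N w (unity_root N \<xi>)))\<^sup>2"
  have "(\<Sum>r<N. ?W (int r) * ((1 - 2 / 3 * (sin (pi * (real r / real N)))\<^sup>2) / real N ^ 4))
      = (\<Sum>r<N. (norm (dft N (T_apply N w) (unity_root N (int r))))\<^sup>2) / real N ^ 4"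
    using norm_dft_T_apply[OF N, of w "int _"] by (simp add: sum_divide_distrib mult_ac)
  also have "\<dots> = (\<Sum>i<N. (T_apply N w i)\<^sup>2) / real N ^ 3"
    unfolding dft_Parseval using N by (simp add: eval_nat_numeral)
  finally have val: "(\<Sum>r<N. ?W (int r) * ((1 - 2 / 3 * (sin (pi * (real r / real N)))\<^sup>2) / real N ^ 4))
      = (\<Sum>i<N. (T_apply N w i)\<^sup>2) / real N ^ 3" .
  have dft0: "dft N w (unity_root N 0) = 0"
    using w by (simp add: dft_def unity_root_def flip: of_real_sum)
  show ?thesis
    unfolding val[symmetric]
  proof (rule has_sum_int_residue_classes[OF N])
    fix r assume r: "r < N"
    show "((\<lambda>m. ?W (int r + m * int N) * (sin (pi * (of_int (int r + m * int N) / real N)) ^ 4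
          / (pi * of_int (int r + m * int N)) ^ 4))
        has_sum ?W (int r) * ((1 - 2 / 3 * (sin (pi * (real r / real N)))\<^sup>2) / real N ^ 4)) UNIV"
    proof (cases "r = 0")
      case True
      then show ?thesis unfolding unity_root_add_multiple[OF N] by (simp add: dft0)
    next
      case False
      then show ?thesis
        unfolding unity_root_add_multiple[OF N] using r
        by (intro has_sum_cmult_right has_sum_residue_class) auto
    qed
  qed
qed

section \<open>The matrices\<close>

text \<open>Summation by parts: in the transform of \<open>S\<^sup>T w\<close> the difference operator moves to the powers of
  \<open>z\<close>, and \<open>z\<^sup>j - z\<^sup>j\<^sup>-\<^sup>1\<close> is \<open>(z - 1) z\<^sup>j\<close> up to the factor \<open>z\<close>.  The identity is cyclic since \<open>z\<^sup>N = 1\<close>.\<close>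

lemma dft_transpose_S_mat:
  assumes w: "w \<in> carrier_vec N" and z: "z ^ N = 1"
  shows "z * dft N (\<lambda>i. (transpose_mat (S_mat N) *\<^sub>v w) $ i) z = (z - 1) * dft N (\<lambda>i. w $ i) z"
proof -
  have [simp]: "complex_of_real (of_bool P) = of_bool P" for P by (cases P) simp_all
  have "dft N (\<lambda>i. (transpose_mat (S_mat N) *\<^sub>v w) $ i) z
      = (\<Sum>i<N. \<Sum>j<N. of_real (w $ j) * ((of_bool (i = j) - of_bool (i = cyc_pred N j)) * z ^ i))"
    unfolding dft_def
    by (intro sum.cong refl)
      (use w in \<open>simp add: S_mat_def scalar_prod_def sum_distrib_left sum_distrib_right mult_ac atLeast0LessThan\<close>)
  also have "\<dots> = (\<Sum>j<N. \<Sum>i<N. of_real (w $ j) * ((of_bool (i = j) - of_bool (i = cyc_pred N j)) * z ^ i))"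
    by (rule sum.swap)
  also have "\<dots> = (\<Sum>j<N. of_real (w $ j) * (z ^ j - z ^ cyc_pred N j))"
  proof (intro sum.cong refl)
    fix j assume "j \<in> {..<N}"
    then have j: "j < N" "cyc_pred N j < N" by (simp_all add: cyc_pred_less)
    have d: "(\<Sum>i<N. of_bool (i = k) * z ^ i) = z ^ k" if "k < N" for k
      using that by (simp add: of_bool_def if_distrib[of "\<lambda>t. t * _"] cong: if_cong)
    show "(\<Sum>i<N. of_real (w $ j) * ((of_bool (i = j) - of_bool (i = cyc_pred N j)) * z ^ i))
        = of_real (w $ j) * (z ^ j - z ^ cyc_pred N j)"
      unfolding sum_distrib_left[symmetric] left_diff_distrib sum_subtractf d[OF j(1)] d[OF j(2)] ..
  qed
  finally have "z * dft N (\<lambda>i. (transpose_mat (S_mat N) *\<^sub>v w) $ i) z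
      = (\<Sum>j<N. z * (of_real (w $ j) * (z ^ j - z ^ cyc_pred N j)))"
    by (simp only: sum_distrib_left)
  also have "\<dots> = (\<Sum>j<N. (z - 1) * (of_real (w $ j) * z ^ j))"
    by (intro sum.cong refl)
      (simp add: right_diff_distrib left_diff_distrib mult.left_commute[of z] power_cyc_pred[OF z])
  finally show ?thesis by (simp only: dft_def sum_distrib_left)
qed

text \<open>\<open>L\<close> subtracts the mean and drops the last entry.\<close>

lemma L_mat_mult_vec:
  assumes "u \<in> carrier_vec N" "(\<Sum>j<N. u $ j) = 0" "i < N - 1"
  shows "(L_mat N *\<^sub>v u) $ i = u $ i"
proof -
  have "(L_mat N *\<^sub>v u) $ i = (\<Sum>j = 0..<N. of_bool (j = i) * u $ j - 1 / real N * u $ j)"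
    using assms by (auto simp: L_mat_def scalar_prod_def left_diff_distrib intro!: sum.cong)
  also have "\<dots> = u $ i"
    using assms sum_of_bool_mult[of i N "\<lambda>j. u $ j"]
    by (simp add: sum_subtractf atLeast0LessThan flip: sum_divide_distrib)
  finally show ?thesis .
qed

text \<open>The vector \<open>S\<^sup>T w\<close> has sum zero, so applying \<open>L\<close> to it only forgets the last entry, and the first
  \<open>N - 1\<close> entries are those of \<open>A A\<^sup>-\<^sup>1 v = v\<close>.  The last entries agree because both vectors have sum
  zero.\<close>

lemma H_mat_mult_vec:
  assumes N: "N \<ge> 3" and v: "(\<Sum>n=1..N. v n) = 0"
  obtains w where "w \<in> carrier_vec N" "(\<Sum>j<N. w $ j) = 0"
    "H_mat N *\<^sub>v vec (N - 1) (\<lambda>i. v (i + 1)) = T_mat N *\<^sub>v w"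
    "\<And>i. i < N \<Longrightarrow> (transpose_mat (S_mat N) *\<^sub>v w) $ i = v (i + 1)"
proof -
  let ?v = "vec (N - 1) (\<lambda>i. v (i + 1))"
  have S: "S_mat N \<in> carrier_mat N N" and R: "R_mat N \<in> carrier_mat N (N - 1)"
    and L: "L_mat N \<in> carrier_mat (N - 1) N" and T: "T_mat N \<in> carrier_mat N N"
    by (simp_all add: S_mat_def R_mat_def L_mat_def T_mat_def)
  have St: "transpose_mat (S_mat N) \<in> carrier_mat N N" using S by simp
  have A: "A_mat N \<in> carrier_mat (N - 1) (N - 1)"
    unfolding A_mat_def using S R L by (intro mult_carrier_mat transpose_carrier_mat) auto
  define B where "B = the (mat_inverse (A_mat N))"
  have B: "B \<in> carrier_mat (N - 1) (N - 1)"
    using A_mat_invertible(1)[OF N] mat_inverse(2)[OF A] unfolding B_def by auto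
  define y where "y = R_mat N *\<^sub>v (B *\<^sub>v ?v)"
  define w where "w = S_mat N *\<^sub>v y"
  define u where "u = transpose_mat (S_mat N) *\<^sub>v w"
  have Bv: "B *\<^sub>v ?v \<in> carrier_vec (N - 1)" using B by simp
  have y: "y \<in> carrier_vec N" unfolding y_def using R Bv by simp
  have w: "w \<in> carrier_vec N" unfolding w_def using S y by simp
  have u: "u \<in> carrier_vec N" unfolding u_def using St w by simp
  have "H_mat N *\<^sub>v ?v = (T_mat N * S_mat N * R_mat N) *\<^sub>v (B *\<^sub>v ?v)"
    unfolding H_mat_def B_def[symmetric] using T S R B
    by (intro assoc_mult_mat_vec mult_carrier_mat) auto
  also have "\<dots> = (T_mat N * S_mat N) *\<^sub>v y"
    unfolding y_def using T S R Bv by (intro assoc_mult_mat_vec mult_carrier_mat) auto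
  also have "\<dots> = T_mat N *\<^sub>v w"
    unfolding w_def using T S y by (intro assoc_mult_mat_vec) auto
  finally have H: "H_mat N *\<^sub>v ?v = T_mat N *\<^sub>v w" .
  have "?v = (A_mat N * B) *\<^sub>v ?v"
    unfolding B_def A_mat_invertible(2)[OF N] by simp
  also have "\<dots> = A_mat N *\<^sub>v (B *\<^sub>v ?v)" using A B by (intro assoc_mult_mat_vec) auto
  also have "\<dots> = (L_mat N * transpose_mat (S_mat N) * S_mat N) *\<^sub>v y"
    unfolding A_mat_def y_def using L St S R Bv by (intro assoc_mult_mat_vec mult_carrier_mat) auto
  also have "\<dots> = (L_mat N * transpose_mat (S_mat N)) *\<^sub>v w"
    unfolding w_def using L St S y by (intro assoc_mult_mat_vec mult_carrier_mat) auto
  also have "\<dots> = L_mat N *\<^sub>v u"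
    unfolding u_def using L St w by (intro assoc_mult_mat_vec) auto
  finally have Lu: "?v = L_mat N *\<^sub>v u" .
  have w0: "(\<Sum>j<N. w $ j) = 0"
  proof -
    have "(\<Sum>j<N. w $ j) = (\<Sum>j<N. y $ j) - (\<Sum>j<N. y $ cyc_pred N j)"
      unfolding w_def using y by (simp add: S_mat_mult_vec flip: sum_subtractf)
    then show ?thesis by (simp add: sum.reindex_bij_betw[OF cyc_pred_bij, of "\<lambda>j. y $ j"])
  qed
  have u0: "(\<Sum>j<N. u $ j) = 0"
    \<comment> \<open>at \<open>z = 1\<close> the transform is the sum of the entries\<close>
    using dft_transpose_S_mat[OF w, of 1] unfolding u_def by (simp add: dft_def flip: of_real_sum)
  have ui: "u $ i = v (i + 1)" if "i < N - 1" for i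
    using L_mat_mult_vec[OF u u0 that] that by (simp flip: Lu)
  have NN: "N = Suc (N - 1)" using N by simp
  have "(\<Sum>i<N. u $ i) = (\<Sum>i<N. v (i + 1))"
    unfolding u0 using v by (simp add: sum.atLeast1_atMost_eq)
  then have "u $ (N - 1) = v (N - 1 + 1)"
    by (subst (asm) (1 2) NN) (simp add: ui)
  then have "u $ i = v (i + 1)" if "i < N" for i
    using ui[of i] that by (cases "i = N - 1") auto
  then show thesis using that[OF w w0 H] unfolding u_def by blast
qed

section \<open>The norm identity\<close>

text \<open>A step function determines its coefficients.  Membership in \<open>V_h0\<close> only provides some
  representation with coefficients of sum zero; this lemma transfers the sum to the given ones.\<close>

lemma step_fun_node:
  assumes "N > 0" "h = 1 / real N" "n \<in> {1..N}"
  shows "step_fun N h v (real n * h) = v n"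
proof -
  have h: "h > 0" using assms by simp
  have "real n * h \<in> grid_interval h m \<longleftrightarrow> m = n" if m: "m \<in> {1..N}" for m
  proof
    assume "real n * h \<in> grid_interval h m"
    then obtain k :: int where k: "(real m - 1/2) * h \<le> real n * h + of_int k"
      "real n * h + of_int k < (real m + 1/2) * h"
      by (auto simp: grid_interval_def)
    have "real n * h + of_int k = of_int (int n + k * int N) * h"
      using assms by (simp add: field_simps)
    with k h have "real m - 1/2 \<le> of_int (int n + k * int N)" "of_int (int n + k * int N) < real m + 1/2"
      by simp_all
    then have e: "int m = int n + k * int N" by linarith
    then have "int N dvd int m - int n" by simp
    then have "int N \<le> \<bar>int m - int n\<bar>" if "m \<noteq> n"
      using that by (intro zdvd_imp_le) (auto simp: dvd_abs_iff)
    then show "m = n" using m assms(3) by fastforce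
  next
    assume "m = n"
    then show "real n * h \<in> grid_interval h m"
      using h by (auto simp: grid_interval_def intro!: exI[of _ "0::int"] mult_strict_right_mono)
  qed
  then have "step_fun N h v (real n * h) = (\<Sum>m=1..N. if m = n then v m else 0)"
    unfolding step_fun_def by (intro sum.cong refl) (auto simp: indicator_def)
  then show ?thesis using assms(3) by simp
qed

lemma Hm1av_norm_step_fun:
  assumes N: "N \<ge> 3" "h = 1 / real N" and w: "w \<in> carrier_vec N" "(\<Sum>j<N. w $ j) = 0"
    and v: "\<And>i. i < N \<Longrightarrow> (transpose_mat (S_mat N) *\<^sub>v w) $ i = v (i + 1)"
  shows "(Hm1av_norm (dist_of_fun (step_fun N h v)))\<^sup>2 = h ^ 3 * (\<Sum>i<N. (T_apply N (\<lambda>i. w $ i) i)\<^sup>2)"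
proof -
  let ?z = "unity_root N" and ?s = "\<lambda>\<xi>. sin (pi * (of_int \<xi> / real N))"
  let ?W = "\<lambda>\<xi>. (norm (dft N (\<lambda>i. w $ i) (?z \<xi>)))\<^sup>2"
  let ?c = "(\<Sum>i<N. (T_apply N (\<lambda>i. w $ i) i)\<^sup>2) / real N ^ 3"
  have N0: "N > 0" using N by simp
  have summand: "1 / (4 * pi\<^sup>2) * ((norm (fourier_coeff (dist_of_fun (step_fun N h v)) \<xi>))\<^sup>2 / (real_of_int \<xi>)\<^sup>2)
      = ?W \<xi> * (?s \<xi> ^ 4 / (pi * of_int \<xi>) ^ 4)" if "\<xi> \<in> UNIV - {0}" for \<xi>
  proof -
    from that have \<xi>: "\<xi> \<noteq> 0" by simp
    have "?z \<xi> * dft N (\<lambda>i. v (i + 1)) (?z \<xi>) = (?z \<xi> - 1) * dft N (\<lambda>i. w $ i) (?z \<xi>)"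
      using dft_transpose_S_mat[OF w(1) unity_root_power_N[OF N0], of \<xi>]
      by (simp add: dft_def v)
    then have "(norm (fourier_coeff (dist_of_fun (step_fun N h v)) \<xi>))\<^sup>2
        = (norm (?z \<xi> - 1))\<^sup>2 * ?W \<xi> * (?s \<xi> / (pi * of_int \<xi>))\<^sup>2"
      unfolding fourier_coeff_step_fun[OF N \<xi>]
      by (simp add: norm_mult power_mult_distrib power_divide norm_divide)
    also have "(norm (?z \<xi> - 1))\<^sup>2 = 4 * (?s \<xi>)\<^sup>2"
      using norm_circulant_symbol[of "-1" 1 N \<xi>] by simp
    finally show ?thesis using \<xi> by (simp add: field_simps eval_nat_numeral)
  qed
  have "((\<lambda>\<xi>. ?W \<xi> * (?s \<xi> ^ 4 / (pi * of_int \<xi>) ^ 4)) has_sum ?c) (UNIV - {0})"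
    using has_sum_weighted_dft[OF N0 w(2)]
    by (subst has_sum_cong_neutral[where T = UNIV
          and g = "\<lambda>\<xi>. ?W \<xi> * (?s \<xi> ^ 4 / (pi * of_int \<xi>) ^ 4)"]) auto
  also have "?this \<longleftrightarrow> ((\<lambda>\<xi>. 1 / (4 * pi\<^sup>2) * ((norm (fourier_coeff (dist_of_fun (step_fun N h v)) \<xi>))\<^sup>2
      / (real_of_int \<xi>)\<^sup>2)) has_sum ?c) (UNIV - {0})"
    by (rule has_sum_cong) (rule summand[symmetric])
  finally have "(Hm1av_norm (dist_of_fun (step_fun N h v)))\<^sup>2 = (sqrt ?c)\<^sup>2"
    unfolding Hm1av_norm_def by (simp only: infsumI)
  also have "\<dots> = ?c" by (simp add: sum_nonneg)
  finally show ?thesis by (simp add: N(2) power_divide)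
qed

theorem mainTheorem1:
  fixes N :: nat and h lam :: real and v :: "nat \<Rightarrow> real"
  assumes "N \<ge> 3" and "h = 1 / real N" and "lam > 0"
    and "step_fun N h v \<in> V_h0 N h"
  shows "lam / 2 * (Hm1av_norm (dist_of_fun (step_fun N h v)))\<^sup>2
       = lam * h ^ 3 / 2 * (eucl_norm (H_mat N *\<^sub>v vec (N - 1) (\<lambda>i. v (i + 1))))\<^sup>2"
proof -
  obtain v' where v': "step_fun N h v = step_fun N h v'" "(\<Sum>n=1..N. v' n) = 0"
    using assms(4) by (auto simp: V_h0_def)
  have "v n = v' n" if "n \<in> {1..N}" for n
    using step_fun_node[OF _ assms(2) that] v'(1) assms(1)
    by (metis less_le_trans zero_less_numeral)
  then have "(\<Sum>n=1..N. v n) = 0" using v'(2) by simp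
  then obtain w where w: "w \<in> carrier_vec N" "(\<Sum>j<N. w $ j) = 0"
    and H: "H_mat N *\<^sub>v vec (N - 1) (\<lambda>i. v (i + 1)) = T_mat N *\<^sub>v w"
    and v: "\<And>i. i < N \<Longrightarrow> (transpose_mat (S_mat N) *\<^sub>v w) $ i = v (i + 1)"
    using H_mat_mult_vec[OF assms(1)] by blast
  have "dim_vec (T_mat N *\<^sub>v w) = N" by (simp add: T_mat_def)
  then have "(eucl_norm (T_mat N *\<^sub>v w))\<^sup>2 = (\<Sum>i<N. (T_apply N (\<lambda>i. w $ i) i)\<^sup>2)"
    unfolding eucl_norm_def L2_set_def
    by (simp add: sum_nonneg T_mat_mult_vec[OF w(1)] T_apply_def del: index_mult_mat_vec)
  moreover have "(Hm1av_norm (dist_of_fun (step_fun N h v)))\<^sup>2 = h ^ 3 * (\<Sum>i<N. (T_apply N (\<lambda>i. w $ i) i)\<^sup>2)"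
    by (rule Hm1av_norm_step_fun[OF assms(1,2) w]) (rule v)
  ultimately show ?thesis unfolding H by simp
qed

end
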